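(* Let $n\ge k\ge 2$ be integers. The following are equivalent. (i) $n\ge R(k)$. (ii) For every $q\in\mathbb{R}$ and every $m\in\mathbb{Z}$, \[ \sum_{U\subseteq\binom{[n]}{k}} (-1)^{(m+1)|U|}\prod_{e\in\binom{[n]}{2}}\cos\!\left(\frac{2\pi}{k(k-1)}\left(q\binom{n-2}{k-2} + m\cdot\mathrm{mult}(e,U)\right)\right)=0. \] (iii) For every $q\in\mathbb{R}$ and every $m\in\mathbb{Z}$, \[ \sum_{G,H}(-1)^{|\mathbf{E}(H)|}\cos\!\left(\frac{\pi q (n-2)!}{k!(n-k)!}\Big(4|\mathbf{E}(G)| - n(n-1)\Big) + \frac{4\pi m}{k(k-1)}\,\mathrm{i}(G,H)\right)=0. \] (iv) \[ \sum_{U\subseteq\binom{[n]}{k}}\prod_{e\in\binom{[n]}{2}}\cos\!\left(-\frac{\pi(n-2)!}{k!(n-k)!} + \frac{2\pi}{k(k-1)}\,\mathrm{mult}(e,U)\right)=0. \] (v) \[ \sum_{G,H}(-1)^{|\mathbf{E}(H)|}\cos\!\left(-\frac{\pi(n-2)!}{k!(n-k)!}\left(2|\mathbf{E}(G)| - \binom{n}{2}\right) + \frac{4\pi}{k(k-1)}\,\mathrm{i}(G,H)\right)=0. \] In (iii) and (v), the sums run over all finite simple undirected graphs $G$ on vertex set $[n]$ and all $k$-uniform hypergraphs $H$ on vertex set $[n]$.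
   Context: $[n]=\{1,\dots,n\}$; $\binom{S}{j}$ is the set of $j$-element subsets of $S$. For $U\subseteq\binom{[n]}{k}$ and $e\in\binom{[n]}{2}$, $\mathrm{mult}(e,U) := \#\{S\in U : e\subseteq S\}$. A $k$-uniform hypergraph $H$ on $[n]$ has edge set $\mathbf{E}(H)\subseteq\binom{[n]}{k}$; a graph $G$ on $[n]$ has edge set $\mathbf{E}(G)\subseteq\binom{[n]}{2}$. The incidence number is $\mathrm{i}(G,H) := \#\{(u,v)\in\mathbf{E}(G)\times\mathbf{E}(H) : u\subseteq v\}$. The $k$-th diagonal Ramsey number $R(k)$ is the least positive integer $n$ such that every graph on $n$ vertices contains a clique of size $k$ or an independent set of size $k$. *)

theory Defs
  imports "HOL-Analysis.Analysis" "HOL-Library.Ramsey"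
begin

definition edge_mult :: "nat set \<Rightarrow> nat set set \<Rightarrow> nat"
  where "edge_mult e U = card {S \<in> U. e \<subseteq> S}"

text \<open>Graphs and uniform hypergraphs on the fixed vertex set \<open>{1..n}\<close> are identified with
  their edge sets, i.e. with the subsets of \<open>[{1..n}]\<^bsup>2\<^esup>\<close> and \<open>[{1..n}]\<^bsup>k\<^esup>\<close> respectively.\<close>

definition graphs :: "nat \<Rightarrow> nat set set set"
  where "graphs n = Pow ([{1..n}]\<^bsup>2\<^esup>)"

definition hypergraphs :: "nat \<Rightarrow> nat \<Rightarrow> nat set set set"
  where "hypergraphs k n = Pow ([{1..n}]\<^bsup>k\<^esup>)"

definition incidence :: "nat set set \<Rightarrow> nat set set \<Rightarrow> nat"
  where "incidence G H = card {(u, v) \<in> G \<times> H. u \<subseteq> v}"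

definition ramsey_property :: "nat \<Rightarrow> nat \<Rightarrow> bool"
  where "ramsey_property k n \<longleftrightarrow>
    (\<forall>(V :: nat set) E. finite V \<and> card V = n \<and> E \<subseteq> [V]\<^bsup>2\<^esup> \<longrightarrow>
       (\<exists>W \<subseteq> V. card W = k \<and> (clique W E \<or> indep W E)))"

definition ramsey_number :: "nat \<Rightarrow> nat"
  where "ramsey_number k = (LEAST n. 0 < n \<and> ramsey_property k n)"

text \<open>By Ramsey's theorem the minimum above is taken over a nonempty set.\<close>

lemma ramsey_property_exists: "\<exists>n>0. ramsey_property k n"
proof -
  obtain r where r: "r \<ge> 1" "\<And>(V :: nat set) E. finite V \<Longrightarrow> card V \<ge> r \<Longrightarrow>
      \<exists>W \<subseteq> V. card W = k \<and> clique W E \<or> card W = k \<and> indep W E"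
    using ramsey2[of k k, where 'a = nat] by blast
  have "ramsey_property k r"
    unfolding ramsey_property_def using r(2) by (metis order_refl)
  with r(1) show ?thesis by (intro exI[of _ r]) auto
qed

end

theory Submission
  imports Defs
begin

text \<open>
  Write \<open>e\<^sub>S\<close> for the number of edges of \<open>G\<close> inside a \<open>k\<close>-set \<open>S\<close>, so that \<open>S\<close> is a clique or an
  independent set iff \<open>e\<^sub>S\<close> is \<open>k choose 2\<close> or \<open>0\<close>, and \<open>i(G, H)\<close> is the sum of \<open>e\<^sub>S\<close> over
  \<open>S \<in> H\<close>. For fixed \<open>G\<close> the alternating sum over \<open>H\<close> of
  \<open>cos (a + 4\<pi>m / (k(k - 1)) \<cdot> i(G, H))\<close> factorises as a cosine times the product over all
  \<open>S\<close> of \<open>2 sin (2\<pi>m e\<^sub>S / (k(k - 1)))\<close>, which vanishes as soon as \<open>G\<close> has a homogeneous \<open>k\<close>-set.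
  In (v) the phase of the remaining cosine is exactly \<open>0\<close>, so (v) is a sum of nonnegative
  terms, one for each \<open>G\<close>, and vanishes iff every \<open>G\<close> has a homogeneous \<open>k\<close>-set.
  Expanding the products of cosines over all sign patterns, a sign pattern being a graph \<open>G\<close>,
  identifies (ii) with (iii) up to a power of two. Finally (iv) and (v) are the case
  \<open>q = -1/2\<close>, \<open>m = 1\<close> of (ii) and (iii).
\<close>

section \<open>Trigonometric sums over subsets\<close>

lemma sum_Pow_insert:
  fixes f :: "'a set \<Rightarrow> 'b::comm_monoid_add"
  assumes "finite A" "x \<notin> A"
  shows "(\<Sum>B\<in>Pow (insert x A). f B) = (\<Sum>B\<in>Pow A. f B) + (\<Sum>B\<in>Pow A. f (insert x B))"
proof -
  have "inj_on (insert x) (Pow A)"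
    using assms(2) by (auto simp: inj_on_def)
  moreover have "Pow A \<inter> insert x ` Pow A = {}"
    using assms(2) by auto
  ultimately show ?thesis
    using assms(1) by (simp add: Pow_insert sum.union_disjoint sum.reindex)
qed

text \<open>The product-to-sum formula with every choice of signs: \<open>G\<close> holds the
  indices that get a plus sign, since \<open>2 * sum x G - sum x A\<close> is the sum of
  \<open>x\<close> over \<open>G\<close> minus its sum over \<open>A - G\<close>. Each new element
  \<open>a\<close> is absorbed by cos (y - x) + cos (y + x) = 2 cos x cos y.\<close>

lemma prod_cos_eq_sum_Pow:
  fixes x :: "'a \<Rightarrow> real"
  assumes "finite A"
  shows "2 ^ card A * (\<Prod>e\<in>A. cos (x e)) = (\<Sum>G\<in>Pow A. cos (2 * sum x G - sum x A))"
  using assms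
proof (induction A rule: finite_induct)
  case empty
  then show ?case by simp
next
  case (insert a A)
  have *: "cos (2 * sum x G - sum x (insert a A)) + cos (2 * sum x (insert a G) - sum x (insert a A))
      = 2 * cos (x a) * cos (2 * sum x G - sum x A)" if "G \<in> Pow A" for G
  proof -
    have "finite G" "a \<notin> G"
      using that insert.hyps finite_subset by auto
    then have "2 * sum x G - sum x (insert a A) = (2 * sum x G - sum x A) - x a"
      "2 * sum x (insert a G) - sum x (insert a A) = (2 * sum x G - sum x A) + x a"
      using insert.hyps by simp_all
    then show ?thesis by (simp only: cos_add cos_diff) simp
  qed
  have "(\<Sum>G\<in>Pow (insert a A). cos (2 * sum x G - sum x (insert a A)))
      = (\<Sum>G\<in>Pow A. 2 * cos (x a) * cos (2 * sum x G - sum x A))"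
    unfolding sum_Pow_insert[OF insert.hyps] sum.distrib[symmetric]
    by (rule sum.cong) (simp_all only: *)
  also have "\<dots> = 2 * cos (x a) * (2 ^ card A * (\<Prod>e\<in>A. cos (x e)))"
    by (simp only: insert.IH sum_distrib_left)
  finally show ?case
    using insert.hyps by simp
qed

text \<open>Over the complex numbers the left side is the real part of exp (i a) times the product
  of the factors 1 - exp (i t), with t = \<open>t S\<close>. Each factor equals 2 sin (t/2) exp (i
  (t/2 - pi/2)), which explains the half angles and the quarter turn per element. The induction
  stays real and keeps \<open>a\<close> arbitrary, because inserting \<open>s\<close> shifts
  \<open>a\<close> by \<open>t s\<close>.\<close>

lemma alternating_sum_Pow_cos:
  fixes t :: "'a \<Rightarrow> real"
  assumes "finite A"
  shows "(\<Sum>H\<in>Pow A. (-1) ^ card H * cos (a + sum t H))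
    = (\<Prod>S\<in>A. 2 * sin (t S / 2)) * cos (a + sum t A / 2 - pi * card A / 2)"
  using assms
proof (induction A arbitrary: a rule: finite_induct)
  case empty
  then show ?case by simp
next
  case (insert s A)
  define P where "P = (\<Prod>S\<in>A. 2 * sin (t S / 2))"
  define w where "w = a + sum t A / 2 - pi * card A / 2"
  have *: "(-1) ^ card (insert s H) * cos (a + sum t (insert s H))
      = - ((-1) ^ card H * cos (a + t s + sum t H))" if "H \<in> Pow A" for H
  proof -
    have "finite H" "s \<notin> H"
      using that insert.hyps finite_subset by auto
    then show ?thesis by (simp add: add.assoc)
  qed
  have "(\<Sum>H\<in>Pow (insert s A). (-1) ^ card H * cos (a + sum t H))
      = (\<Sum>H\<in>Pow A. (-1) ^ card H * cos (a + sum t H))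
        - (\<Sum>H\<in>Pow A. (-1) ^ card H * cos (a + t s + sum t H))"
    unfolding sum_Pow_insert[OF insert.hyps] using * by (simp add: sum_negf)
  also have "\<dots> = P * cos w - P * cos (w + t s)"
    unfolding insert.IH P_def w_def by (simp add: algebra_simps)
  also have "\<dots> = P * (2 * sin (t s / 2) * sin (w + t s / 2))"
  proof -
    have "(w + (w + t s)) / 2 = w + t s / 2" "(w + t s - w) / 2 = t s / 2"
      by (simp_all add: field_simps)
    then have "cos w - cos (w + t s) = 2 * sin (t s / 2) * sin (w + t s / 2)"
      using cos_diff_cos[of w "w + t s"] by (simp only: mult.assoc mult.commute mult.left_commute)
    then show ?thesis by (simp add: algebra_simps)
  qed
  also have "sin (w + t s / 2) = cos (w + t s / 2 - pi / 2)"
    by (simp add: cos_diff)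
  also have "w + t s / 2 - pi / 2 = a + sum t (insert s A) / 2 - pi * card (insert s A) / 2"
    using insert.hyps by (simp add: w_def field_simps)
  finally show ?case
    using insert.hyps by (simp add: P_def)
qed

section \<open>Counting edges in vertex sets\<close>

definition edges_in :: "nat set set \<Rightarrow> nat set \<Rightarrow> nat"
  where "edges_in G S = card {e \<in> G. e \<subseteq> S}"

text \<open>Slices the incident pairs by hyperedge; the next lemma slices them by edge. The first
  form makes the phase additive in \<open>H\<close> for a fixed graph, the second additive in
  \<open>G\<close> for a fixed hypergraph.\<close>

lemma incidence_eq_sum_edges_in:
  assumes "finite G" "finite H"
  shows "incidence G H = (\<Sum>S\<in>H. edges_in G S)"
proof -
  have "{(u, v) \<in> G \<times> H. u \<subseteq> v} = prod.swap ` (SIGMA v:H. {u \<in> G. u \<subseteq> v})"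
    by force
  then have "incidence G H = card (SIGMA v:H. {u \<in> G. u \<subseteq> v})"
    by (simp add: incidence_def card_image)
  then show ?thesis
    using assms by (simp add: edges_in_def)
qed

lemma incidence_eq_sum_edge_mult:
  assumes "finite G" "finite H"
  shows "incidence G H = (\<Sum>e\<in>G. edge_mult e H)"
proof -
  have "{(u, v) \<in> G \<times> H. u \<subseteq> v} = (SIGMA u:G. {v \<in> H. u \<subseteq> v})"
    by auto
  then show ?thesis
    using assms by (simp add: incidence_def edge_mult_def)
qed

text \<open>Deleting \<open>e\<close> matches the k-sets containing \<open>e\<close> with the
  (k-j)-subsets of \<open>V - e\<close>. The case j = 2 shows that all edges have the same
  multiplicity in the complete hypergraph.\<close>

lemma edge_mult_nsets:
  assumes "finite V" "e \<in> [V]\<^bsup>j\<^esup>" "j \<le> k"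
  shows "edge_mult e ([V]\<^bsup>k\<^esup>) = (card V - j) choose (k - j)"
proof -
  have e: "e \<subseteq> V" "finite e" "card e = j"
    using assms(2) by (auto simp: nsets_def)
  have "bij_betw (\<lambda>T. T \<union> e) ([V - e]\<^bsup>(k - j)\<^esup>) {S \<in> [V]\<^bsup>k\<^esup>. e \<subseteq> S}"
  proof (rule bij_betwI[where g = "\<lambda>S. S - e"])
    show "(\<lambda>T. T \<union> e) \<in> [V - e]\<^bsup>(k - j)\<^esup> \<rightarrow> {S \<in> [V]\<^bsup>k\<^esup>. e \<subseteq> S}"
    proof
      fix T assume T: "T \<in> [V - e]\<^bsup>(k - j)\<^esup>"
      then have "card (T \<union> e) = card T + card e"
        using e by (intro card_Un_disjoint) (auto simp: nsets_def)
      with T e assms(3) show "T \<union> e \<in> {S \<in> [V]\<^bsup>k\<^esup>. e \<subseteq> S}"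
        by (auto simp: nsets_def)
    qed
    show "(\<lambda>S. S - e) \<in> {S \<in> [V]\<^bsup>k\<^esup>. e \<subseteq> S} \<rightarrow> [V - e]\<^bsup>(k - j)\<^esup>"
      using e by (auto simp: nsets_def card_Diff_subset)
  qed (auto simp: nsets_def)
  from bij_betw_same_card[OF this] have "edge_mult e ([V]\<^bsup>k\<^esup>) = card ([V - e]\<^bsup>(k - j)\<^esup>)"
    by (simp add: edge_mult_def)
  then show ?thesis
    using e by (simp add: card_nsets card_Diff_subset)
qed

lemma edges_in_nsets:
  assumes "S \<subseteq> V"
  shows "edges_in ([V]\<^bsup>2\<^esup>) S = card S choose 2"
proof -
  have "{e \<in> [V]\<^bsup>2\<^esup>. e \<subseteq> S} = [S]\<^bsup>2\<^esup>"
    using assms by (auto simp: nsets_def)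
  then show ?thesis by (simp add: edges_in_def card_nsets)
qed

text \<open>\<open>indep\<close> tests only pairs of distinct vertices, so the assumption on
  \<open>G\<close> excludes singletons and larger sets that \<open>edges_in\<close> would count and
  \<open>indep\<close> would miss.\<close>

lemma edges_in_eq_0_iff:
  assumes "finite S" "G \<subseteq> [V]\<^bsup>2\<^esup>"
  shows "edges_in G S = 0 \<longleftrightarrow> indep S G"
proof -
  have "finite {e \<in> G. e \<subseteq> S}"
    by (rule finite_subset[of _ "Pow S"]) (use assms in auto)
  then have "edges_in G S = 0 \<longleftrightarrow> (\<forall>e\<in>G. \<not> e \<subseteq> S)"
    by (auto simp: edges_in_def)
  also have "\<dots> \<longleftrightarrow> indep S G"
  proof
    assume "indep S G"
    then show "\<forall>e\<in>G. \<not> e \<subseteq> S"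
      using assms(2) by (fastforce simp: indep_def nsets_def card_2_iff)
  qed (auto simp: indep_def)
  finally show ?thesis .
qed

lemma
  assumes "finite S" "G \<subseteq> [V]\<^bsup>2\<^esup>"
  shows edges_in_le: "edges_in G S \<le> card S choose 2"
    and edges_in_eq_choose_iff: "edges_in G S = card S choose 2 \<longleftrightarrow> clique S G"
proof -
  have sub: "{e \<in> G. e \<subseteq> S} \<subseteq> [S]\<^bsup>2\<^esup>"
    using assms(2) by (auto simp: nsets_def)
  have fin: "finite ([S]\<^bsup>2\<^esup>)"
    using assms(1) by (simp add: finite_imp_finite_nsets)
  show "edges_in G S \<le> card S choose 2"
    using card_mono[OF fin sub] by (simp add: edges_in_def card_nsets)
  have "edges_in G S = card S choose 2 \<longleftrightarrow> {e \<in> G. e \<subseteq> S} = [S]\<^bsup>2\<^esup>"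
    using card_subset_eq[OF fin sub] by (auto simp: edges_in_def card_nsets)
  also have "\<dots> \<longleftrightarrow> [S]\<^bsup>2\<^esup> \<subseteq> G"
    using sub by (auto simp: nsets_def)
  also have "\<dots> \<longleftrightarrow> clique S G"
  proof
    assume "clique S G"
    then show "[S]\<^bsup>2\<^esup> \<subseteq> G"
      by (fastforce simp: clique_def nsets_def card_2_iff)
  next
    assume "[S]\<^bsup>2\<^esup> \<subseteq> G"
    then show "clique S G"
      by (auto simp: clique_def nsets_def)
  qed
  finally show "edges_in G S = card S choose 2 \<longleftrightarrow> clique S G" .
qed

section \<open>The Ramsey property\<close>

text \<open>Restrict the graph to \<open>m\<close> of its vertices. This is needed because the
  definition of R(k) as a minimum gives the property only at R(k) itself.\<close>

lemma ramsey_property_mono: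
  assumes "ramsey_property k m" "m \<le> n"
  shows "ramsey_property k n"
  unfolding ramsey_property_def
proof (intro allI impI)
  fix V :: "nat set" and E
  assume V: "finite V \<and> card V = n \<and> E \<subseteq> [V]\<^bsup>2\<^esup>"
  then obtain V' where V': "V' \<subseteq> V" "finite V'" "card V' = m"
    using assms(2) obtain_subset_with_card_n by metis
  have "E \<inter> [V']\<^bsup>2\<^esup> \<subseteq> [V']\<^bsup>2\<^esup>" by simp
  then obtain W where W: "W \<subseteq> V'" "card W = k"
      "clique W (E \<inter> [V']\<^bsup>2\<^esup>) \<or> indep W (E \<inter> [V']\<^bsup>2\<^esup>)"
    using assms(1) V' unfolding ramsey_property_def by blast
  have "{v, w} \<in> [V']\<^bsup>2\<^esup>" if "v \<in> W" "w \<in> W" "v \<noteq> w" for v w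
    using that W(1) by (auto simp: nsets_def)
  then have "clique W E \<or> indep W E"
    using W(3) by (auto simp: clique_def indep_def)
  then show "\<exists>W\<subseteq>V. card W = k \<and> (clique W E \<or> indep W E)"
    using W V' by blast
qed

lemma ramsey_property_iff:
  "ramsey_property k n \<longleftrightarrow>
    (\<forall>G\<in>graphs n. \<exists>S\<in>[{1..n}]\<^bsup>k\<^esup>. clique S G \<or> indep S G)"
proof
  assume *: "ramsey_property k n"
  show "\<forall>G\<in>graphs n. \<exists>S\<in>[{1..n}]\<^bsup>k\<^esup>. clique S G \<or> indep S G"
  proof
    fix G assume "G \<in> graphs n"
    then have "finite {1..n} \<and> card {1..n} = n \<and> G \<subseteq> [{1..n}]\<^bsup>2\<^esup>"
      by (simp add: graphs_def)
    then obtain W where "W \<subseteq> {1..n}" "card W = k" "clique W G \<or> indep W G"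
      using * unfolding ramsey_property_def by blast
    moreover from this have "W \<in> [{1..n}]\<^bsup>k\<^esup>"
      using finite_subset[of W "{1..n}"] by (simp add: nsets_def)
    ultimately show "\<exists>S\<in>[{1..n}]\<^bsup>k\<^esup>. clique S G \<or> indep S G"
      by blast
  qed
next
  assume *: "\<forall>G\<in>graphs n. \<exists>S\<in>[{1..n}]\<^bsup>k\<^esup>. clique S G \<or> indep S G"
  show "ramsey_property k n"
    unfolding ramsey_property_def
  proof (intro allI impI)
    fix V :: "nat set" and E
    assume V: "finite V \<and> card V = n \<and> E \<subseteq> [V]\<^bsup>2\<^esup>"
    then obtain f where f: "bij_betw f {1..n} V"
      using ex_bij_betw_nat_finite_1 by blast
    \<comment> \<open>Pull \<open>E\<close> back along the bijection, so that a homogeneous set of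
      \<open>G\<close> is carried by \<open>f\<close> to one of \<open>E\<close>.\<close>
    define G where "G = {e \<in> [{1..n}]\<^bsup>2\<^esup>. f ` e \<in> E}"
    have "G \<in> graphs n"
      by (auto simp: G_def graphs_def)
    then obtain S where S: "S \<in> [{1..n}]\<^bsup>k\<^esup>" "clique S G \<or> indep S G"
      using * by blast
    have inj: "inj_on f S"
      using f S(1) by (auto simp: bij_betw_def nsets_def intro: inj_on_subset)
    have "{f v, f w} \<in> E \<longleftrightarrow> {v, w} \<in> G" if "v \<in> S" "w \<in> S" "f v \<noteq> f w" for v w
      using that S(1) by (auto simp: G_def nsets_def card_2_iff)
    then have "clique S G \<longrightarrow> clique (f ` S) E" "indep S G \<longrightarrow> indep (f ` S) E"
      by (auto simp: clique_def indep_def)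
    then have "clique (f ` S) E \<or> indep (f ` S) E"
      using S(2) by blast
    moreover have "f ` S \<subseteq> V"
      using f S(1) by (auto simp: bij_betw_def nsets_def)
    moreover have "card (f ` S) = k"
      using S(1) inj by (simp add: card_image nsets_def)
    ultimately show "\<exists>W\<subseteq>V. card W = k \<and> (clique W E \<or> indep W E)"
      by blast
  qed
qed

lemma ramsey_number_le_iff:
  assumes "0 < n"
  shows "ramsey_number k \<le> n \<longleftrightarrow> ramsey_property k n"
proof
  assume "ramsey_number k \<le> n"
  moreover have "ramsey_property k (ramsey_number k)"
    unfolding ramsey_number_def using LeastI_ex[OF ramsey_property_exists[of k]] by simp
  ultimately show "ramsey_property k n"
    using ramsey_property_mono by blast
next
  assume "ramsey_property k n"
  then show "ramsey_number k \<le> n"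
    unfolding ramsey_number_def using assms by (simp add: Least_le)
qed

section \<open>The trigonometric criteria\<close>

lemma real_choose_two: "2 * real (n choose 2) = real n * (real n - 1)"
  by (induction n) (auto simp: numeral_2_eq_2 algebra_simps)

text \<open>Both sides count the pairs of a k-set and a 2-subset of it. This identity is behind the
  cancellation of phases in (v).\<close>

lemma choose_two_mult_choose:
  assumes "2 \<le> k" "k \<le> n"
  shows "(n choose 2) * ((n - 2) choose (k - 2)) = (n choose k) * (k choose 2)"
  using choose_mult[of 2 k n] assms by simp

text \<open>Brings the factorial coefficients of (iii), (iv) and (v) to the binomial form used in
  (ii).\<close>

lemma fact_quotient_eq_choose:
  assumes "2 \<le> k" "k \<le> n"
  shows "fact (n - 2) / (fact k * fact (n - k))
    = real ((n - 2) choose (k - 2)) / (real k * (real k - 1))"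
proof -
  obtain j where j: "k = Suc (Suc j)"
    using assms(1) by (metis Suc_le_D numeral_2_eq_2 Suc_le_mono)
  have "real ((n - 2) choose j) = fact (n - 2) / (fact j * fact (n - 2 - j))"
    by (rule binomial_fact) (use assms j in simp)
  moreover have "n - 2 - j = n - k"
    using j by simp
  moreover have "(fact k :: real) = real k * (real k - 1) * fact j"
    by (simp add: j algebra_simps)
  ultimately show ?thesis
    using j by simp
qed

text \<open>Evaluates the inner sum over \<open>H\<close> for each fixed \<open>G\<close>. The
  remaining phase contains half the incidence with the complete hypergraph, which depends on
  \<open>G\<close> only through its number of edges.\<close>

lemma sum_graphs_hypergraphs_cos:
  assumes "2 \<le> k"
  shows "(\<Sum>(G, H)\<in>graphs n \<times> hypergraphs k n.
      (-1) ^ card H * cos (a G + t * real (incidence G H)))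
    = (\<Sum>G\<in>graphs n. (\<Prod>S\<in>[{1..n}]\<^bsup>k\<^esup>. 2 * sin (t * real (edges_in G S) / 2)) *
        cos (a G + t * (real (card G) * real ((n - 2) choose (k - 2))) / 2
             - pi * real (n choose k) / 2))"
proof -
  let ?K = "[{1..n}]\<^bsup>k\<^esup>"
  have finK: "finite ?K"
    by (simp add: finite_imp_finite_nsets)
  have "(\<Sum>H\<in>hypergraphs k n. (-1) ^ card H * cos (a G + t * real (incidence G H)))
      = (\<Prod>S\<in>?K. 2 * sin (t * real (edges_in G S) / 2)) *
        cos (a G + t * (real (card G) * real ((n - 2) choose (k - 2))) / 2
             - pi * real (n choose k) / 2)" if "G \<in> graphs n" for G
  proof -
    have G: "G \<subseteq> [{1..n}]\<^bsup>2\<^esup>"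
      using that by (simp add: graphs_def)
    then have finG: "finite G"
      using finite_subset finite_imp_finite_nsets[of "{1..n}" 2] by blast
    have inc: "t * real (incidence G H) = (\<Sum>S\<in>H. t * real (edges_in G S))" if "H \<subseteq> ?K" for H
      using incidence_eq_sum_edges_in[OF finG finite_subset[OF that finK]]
      by (simp add: sum_distrib_left)
    have "incidence G ?K = (\<Sum>e\<in>G. (n - 2) choose (k - 2))"
      unfolding incidence_eq_sum_edge_mult[OF finG finK]
      using G assms by (intro sum.cong) (auto simp: edge_mult_nsets)
    then have total: "(\<Sum>S\<in>?K. t * real (edges_in G S))
        = t * (real (card G) * real ((n - 2) choose (k - 2)))"
      using inc[of ?K] by simp
    have "(\<Sum>H\<in>hypergraphs k n. (-1) ^ card H * cos (a G + t * real (incidence G H)))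
        = (\<Sum>H\<in>Pow ?K. (-1) ^ card H * cos (a G + (\<Sum>S\<in>H. t * real (edges_in G S))))"
      unfolding hypergraphs_def by (rule sum.cong) (auto simp: inc)
    then show ?thesis
      unfolding alternating_sum_Pow_cos[OF finK] total by (simp add: card_nsets)
  qed
  then show ?thesis
    by (simp add: sum.cartesian_product[symmetric])
qed

text \<open>A homogeneous \<open>S\<close> contributes the factor sin 0 or sin (pi m) to the product
  for \<open>G\<close>. The phase \<open>a\<close> stays arbitrary, which covers every
  \<open>q\<close> at once.\<close>

lemma sum_graphs_hypergraphs_eq_0:
  fixes m :: int
  assumes "2 \<le> k" "ramsey_property k n"
  shows "(\<Sum>(G, H)\<in>graphs n \<times> hypergraphs k n. (-1) ^ card H *
      cos (a G + 4 * pi * of_int m / (real k * (real k - 1)) * real (incidence G H))) = 0"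
  unfolding sum_graphs_hypergraphs_cos[OF assms(1)]
proof (rule sum.neutral, rule ballI)
  fix G assume G: "G \<in> graphs n"
  then obtain S where S: "S \<in> [{1..n}]\<^bsup>k\<^esup>" "clique S G \<or> indep S G"
    using assms(2) by (auto simp: ramsey_property_iff)
  have S': "finite S" "card S = k"
    using S(1) by (auto simp: nsets_def)
  have G': "G \<subseteq> [{1..n}]\<^bsup>2\<^esup>"
    using G by (simp add: graphs_def)
  let ?x = "4 * pi * of_int m / (real k * (real k - 1)) * real (edges_in G S) / 2"
  have "edges_in G S = 0 \<or> edges_in G S = k choose 2"
    using S(2) S' edges_in_eq_0_iff[OF S'(1) G'] edges_in_eq_choose_iff[OF S'(1) G'] by auto
  then have "?x = 0 \<or> ?x = pi * of_int m"
  proof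
    assume "edges_in G S = k choose 2"
    then have "2 * real (edges_in G S) = real k * (real k - 1)"
      by (simp add: real_choose_two)
    moreover have "real k * (real k - 1) \<noteq> 0"
      using assms(1) by simp
    moreover have "?x = pi * of_int m * (2 * real (edges_in G S) / (real k * (real k - 1)))"
      by simp
    ultimately have "?x = pi * of_int m"
      by (simp only: divide_self_if if_False mult_1_right)
    then show ?thesis ..
  qed simp
  then have "sin ?x = 0"
    by (auto simp: sin_zero_iff_int2)
  then have "(\<Prod>S\<in>[{1..n}]\<^bsup>k\<^esup>. 2 * sin (4 * pi * of_int m / (real k * (real k - 1)) *
      real (edges_in G S) / 2)) = 0"
    using S(1) by (intro prod_zero bexI[of _ S]) (auto simp: finite_imp_finite_nsets)
  then show "(\<Prod>S\<in>[{1..n}]\<^bsup>k\<^esup>. 2 * sin (4 * pi * of_int m / (real k * (real k - 1)) *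
      real (edges_in G S) / 2)) *
      cos (a G + 4 * pi * of_int m / (real k * (real k - 1)) *
        (real (card G) * real ((n - 2) choose (k - 2))) / 2 - pi * real (n choose k) / 2) = 0"
    by simp
qed

lemma ramsey_property_if_sum_eq_0:
  assumes k: "2 \<le> k" "k \<le> n"
    and zero: "(\<Sum>(G, H)\<in>graphs n \<times> hypergraphs k n. (-1) ^ card H *
      cos (- (pi * fact (n - 2) / (fact k * fact (n - k))) * (2 * real (card G) - real (n choose 2))
           + 4 * pi / (real k * (real k - 1)) * real (incidence G H))) = 0"
  shows "ramsey_property k n"
proof -
  define w where "w = real k * (real k - 1)"
  define B where "B = real ((n - 2) choose (k - 2))"
  define c where "c = pi * fact (n - 2) / (fact k * fact (n - k))"
  define P where "P G = (\<Prod>S\<in>[{1..n}]\<^bsup>k\<^esup>. 2 * sin (4 * pi / w * real (edges_in G S) / 2))" for G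
  have w: "w > 0"
    using k by (simp add: w_def)
  have c: "c = pi * B / w"
    using fact_quotient_eq_choose[OF k] unfolding c_def B_def w_def
    by (metis times_divide_eq_right)
  have "2 * (real (n choose 2) * B) = real (n choose k) * w"
    using choose_two_mult_choose[OF k, THEN arg_cong[of _ _ real]] real_choose_two[of k]
    by (simp add: B_def w_def)
  \<comment> \<open>The phases cancel: this is what singles out \<open>q = -1/2\<close>.\<close>
  then have phase: "- c * (2 * real (card G) - real (n choose 2))
      + 4 * pi / w * (real (card G) * B) / 2 - pi * real (n choose k) / 2 = 0" for G :: "nat set set"
    using w by (simp add: c field_simps)
  have sum0: "(\<Sum>G\<in>graphs n. P G) = 0"
    using zero sum_graphs_hypergraphs_cos[OF k(1), where n = n and t = "4 * pi / w" and a =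
        "\<lambda>G. - c * (2 * real (card G) - real (n choose 2))"]
    unfolding B_def[symmetric] w_def[symmetric] c_def[symmetric] phase P_def by simp
  \<comment> \<open>Since \<open>S\<close> spans at most \<open>w / 2\<close> edges, the angle lies
    between 0 and pi. So its sine is nonnegative and vanishes only at the ends, that is, for
    independent sets and cliques.\<close>
  have arg: "0 \<le> x \<and> x \<le> pi \<and> (sin x = 0 \<longrightarrow> clique S G \<or> indep S G)"
    if "G \<in> graphs n" "S \<in> [{1..n}]\<^bsup>k\<^esup>" "x = 4 * pi / w * real (edges_in G S) / 2" for G S x
  proof -
    have G: "G \<subseteq> [{1..n}]\<^bsup>2\<^esup>" and S: "finite S" "card S = k"
      using that by (auto simp: graphs_def nsets_def)
    have "real (edges_in G S) \<le> real (k choose 2)"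
      using edges_in_le[OF S(1) G] S by simp
    then have le: "2 * real (edges_in G S) \<le> w"
      using real_choose_two[of k] by (simp add: w_def)
    have x_eq: "x = pi * (2 * real (edges_in G S) / w)"
      using that(3) by simp
    have "2 * real (edges_in G S) / w \<le> 1"
      using le w by simp
    then have "x \<le> pi"
      unfolding x_eq by (rule mult_left_le) simp
    moreover have "0 \<le> x"
      unfolding x_eq using w by simp
    moreover have "clique S G \<or> indep S G" if "sin x = 0"
    proof -
      have "\<not> (0 < x \<and> x < pi)"
        using that sin_gt_zero[of x] by auto
      then have "x = 0 \<or> x = pi"
        using \<open>0 \<le> x\<close> \<open>x \<le> pi\<close> by auto
      then have "edges_in G S = 0 \<or> 2 * real (edges_in G S) = w"
        using w x_eq by (auto simp: field_simps)
      then have "edges_in G S = 0 \<or> edges_in G S = card S choose 2"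
        using real_choose_two[of k] S by (auto simp: w_def)
      then show ?thesis
        using edges_in_eq_0_iff[OF S(1) G] edges_in_eq_choose_iff[OF S(1) G] by blast
    qed
    ultimately show ?thesis by blast
  qed
  have nonneg: "0 \<le> P G" if "G \<in> graphs n" for G
    unfolding P_def using arg[OF that] by (intro prod_nonneg) (simp add: sin_ge_zero)
  have "finite (graphs n)"
    by (simp add: graphs_def finite_imp_finite_nsets)
  then have "\<forall>G\<in>graphs n. P G = 0"
    using sum0 nonneg sum_nonneg_eq_0_iff[of "graphs n" P] by blast
  then have "\<forall>G\<in>graphs n. \<exists>S\<in>[{1..n}]\<^bsup>k\<^esup>. sin (4 * pi / w * real (edges_in G S) / 2) = 0"
    unfolding P_def by (simp add: prod_zero_iff finite_imp_finite_nsets)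
  then show ?thesis
    unfolding ramsey_property_iff using arg[OF _ _ refl] by blast
qed

lemma sum_prod_cos_eq_sum_graphs_hypergraphs:
  fixes q :: real and m :: int
  assumes k: "2 \<le> k" "k \<le> n"
  shows "2 ^ (n choose 2) * (\<Sum>U \<in> Pow ([{1..n}]\<^bsup>k\<^esup>). (-1) powi ((m + 1) * int (card U)) *
      (\<Prod>e \<in> [{1..n}]\<^bsup>2\<^esup>. cos (2 * pi / (real k * (real k - 1)) *
        (q * real ((n - 2) choose (k - 2)) + of_int m * real (edge_mult e U)))))
    = (\<Sum>(G, H) \<in> graphs n \<times> hypergraphs k n. (-1) ^ card H *
        cos (pi * q * fact (n - 2) / (fact k * fact (n - k)) *
               (4 * real (card G) - real n * (real n - 1))
             + 4 * pi * of_int m / (real k * (real k - 1)) * real (incidence G H)))"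
proof -
  define w where "w = real k * (real k - 1)"
  define B where "B = real ((n - 2) choose (k - 2))"
  let ?E = "[{1..n}]\<^bsup>2\<^esup>" and ?K = "[{1..n}]\<^bsup>k\<^esup>"
  have w: "w > 0"
    using k by (simp add: w_def)
  have c: "pi * q * fact (n - 2) / (fact k * fact (n - k)) = pi * q * (B / w)"
    using fact_quotient_eq_choose[OF k] unfolding B_def w_def
    by (metis times_divide_eq_right)
  have finE: "finite ?E" and finK: "finite ?K"
    by (simp_all add: finite_imp_finite_nsets)
  have U_term: "2 ^ (n choose 2) * ((-1) powi ((m + 1) * int (card U)) *
      (\<Prod>e\<in>?E. cos (2 * pi / w * (q * B + of_int m * real (edge_mult e U)))))
    = (\<Sum>G\<in>graphs n. (-1) ^ card U *
        cos (pi * q * (B / w) * (4 * real (card G) - real n * (real n - 1))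
             + 4 * pi * of_int m / w * real (incidence G U)))" if "U \<in> Pow ?K" for U
  proof -
    define x where "x e = 2 * pi / w * (q * B + of_int m * real (edge_mult e U))" for e
    have finU: "finite U"
      using that finK finite_subset by auto
    have sum_x: "sum x G = 2 * pi / w * (q * B * real (card G) + of_int m * real (incidence G U))"
      if "G \<subseteq> ?E" for G
      using incidence_eq_sum_edge_mult[OF finite_subset[OF that finE] finU]
      by (simp add: x_def sum.distrib mult.commute flip: sum_distrib_left sum_divide_distrib)
    have "edges_in ?E S = k choose 2" if "S \<in> U" for S
      using that \<open>U \<in> Pow ?K\<close> edges_in_nsets[of S "{1..n}"] by (auto simp: nsets_def)
    then have "incidence ?E U = card U * (k choose 2)"
      unfolding incidence_eq_sum_edges_in[OF finE finU] by simp
    then have "real (incidence ?E U) = real (card U) * w / 2"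
      using real_choose_two[of k] by (simp add: w_def)
    moreover have "real (card ?E) = real n * (real n - 1) / 2"
      by (simp add: card_nsets flip: real_choose_two)
    \<comment> \<open>The shift by pi m |U| comes from \<open>sum x ?E\<close>: each of the |U|
      hyperedges meets the complete graph in \<open>w / 2\<close> edges, each weighted by 2 pi m /
      w.\<close>
    ultimately have arg: "2 * sum x G - sum x ?E
        = (pi * q * (B / w) * (4 * real (card G) - real n * (real n - 1))
           + 4 * pi * of_int m / w * real (incidence G U)) - pi * of_int (m * int (card U))"
      if "G \<subseteq> ?E" for G
      using w by (simp only: sum_x[OF that] sum_x[OF order_refl]) (simp add: field_simps)
    have shift: "cos (y - pi * of_int j) = (-1) powi j * cos y" for y and j :: int
      by (simp add: cos_diff)
    \<comment> \<open>The exponents add up to 2m|U| + |U|, so the shift turns the sign of (ii) into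
      that of (iii). Integer powers are used because \<open>m\<close> may be negative.\<close>
    have sign: "(-1) powi ((m + 1) * int (card U)) * (-1) powi (m * int (card U)) = (-1::real) ^ card U"
    proof -
      have "(-1::real) powi j * (-1) powi j = 1" for j :: int
        by (simp flip: power_int_mult_distrib)
      then show ?thesis
        by (simp add: distrib_right power_int_add)
    qed
    have "2 ^ (n choose 2) * ((-1) powi ((m + 1) * int (card U)) * (\<Prod>e\<in>?E. cos (x e)))
      = (-1) powi ((m + 1) * int (card U)) * (\<Sum>G\<in>Pow ?E. cos (2 * sum x G - sum x ?E))"
      using prod_cos_eq_sum_Pow[OF finE, of x] by (simp add: card_nsets)
    also have "\<dots> = (\<Sum>G\<in>graphs n. (-1) ^ card U *
        cos (pi * q * (B / w) * (4 * real (card G) - real n * (real n - 1))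
             + 4 * pi * of_int m / w * real (incidence G U)))"
      unfolding sum_distrib_left[of "(-1) powi _"] graphs_def
      by (rule sum.cong) (simp_all only: arg shift Pow_iff mult.assoc[symmetric] sign)
    finally show ?thesis
      by (simp add: x_def)
  qed
  show ?thesis
    unfolding c w_def[symmetric] B_def[symmetric] sum_distrib_left hypergraphs_def
      sum.cartesian_product[symmetric]
    by (subst sum.swap) (rule sum.cong[OF refl U_term])
qed

theorem theorem4p1:
  fixes n k :: nat
  assumes "2 \<le> k" and "k \<le> n"
  shows
    "(n \<ge> ramsey_number k \<longleftrightarrow>
        (\<forall>(q::real) (m::int).
          (\<Sum>U \<in> Pow ([{1..n}]\<^bsup>k\<^esup>).
             (-1) powi ((m + 1) * int (card U)) *
             (\<Prod>e \<in> [{1..n}]\<^bsup>2\<^esup>.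
                cos (2 * pi / (real k * (real k - 1)) *
                     (q * real ((n - 2) choose (k - 2)) + of_int m * real (edge_mult e U))))) = 0))
   \<and> (n \<ge> ramsey_number k \<longleftrightarrow>
        (\<forall>(q::real) (m::int).
          (\<Sum>(G, H) \<in> graphs n \<times> hypergraphs k n.
             (-1) ^ card H *
             cos (pi * q * fact (n - 2) / (fact k * fact (n - k)) *
                    (4 * real (card G) - real n * (real n - 1))
                  + 4 * pi * of_int m / (real k * (real k - 1)) * real (incidence G H))) = 0))
   \<and> (n \<ge> ramsey_number k \<longleftrightarrow>
        (\<Sum>U \<in> Pow ([{1..n}]\<^bsup>k\<^esup>).
           \<Prod>e \<in> [{1..n}]\<^bsup>2\<^esup>.
             cos (- (pi * fact (n - 2) / (fact k * fact (n - k)))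
                  + 2 * pi / (real k * (real k - 1)) * real (edge_mult e U))) = 0)
   \<and> (n \<ge> ramsey_number k \<longleftrightarrow>
        (\<Sum>(G, H) \<in> graphs n \<times> hypergraphs k n.
           (-1) ^ card H *
           cos (- (pi * fact (n - 2) / (fact k * fact (n - k))) *
                  (2 * real (card G) - real (n choose 2))
                + 4 * pi / (real k * (real k - 1)) * real (incidence G H))) = 0)"
proof -
  define F where "F q m = (\<Sum>(G, H) \<in> graphs n \<times> hypergraphs k n. (-1) ^ card H *
        cos (pi * q * fact (n - 2) / (fact k * fact (n - k)) *
               (4 * real (card G) - real n * (real n - 1))
             + 4 * pi * of_int m / (real k * (real k - 1)) * real (incidence G H)))"
    for q :: real and m :: int
  define P where "P q m = (\<Sum>U \<in> Pow ([{1..n}]\<^bsup>k\<^esup>). (-1) powi ((m + 1) * int (card U)) *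
      (\<Prod>e \<in> [{1..n}]\<^bsup>2\<^esup>. cos (2 * pi / (real k * (real k - 1)) *
        (q * real ((n - 2) choose (k - 2)) + of_int m * real (edge_mult e U)))))"
    for q :: real and m :: int
  have PF: "P q m = 0 \<longleftrightarrow> F q m = 0" for q m
    using sum_prod_cos_eq_sum_graphs_hypergraphs[OF assms, of m q, folded F_def P_def]
    by (metis mult_eq_0_iff power_not_zero zero_neq_numeral)
  have v: "(\<Sum>(G, H) \<in> graphs n \<times> hypergraphs k n. (-1) ^ card H *
           cos (- (pi * fact (n - 2) / (fact k * fact (n - k))) *
                  (2 * real (card G) - real (n choose 2))
                + 4 * pi / (real k * (real k - 1)) * real (incidence G H))) = F (-1/2) 1"
  proof -
    have "- (pi * fact (n - 2) / (fact k * fact (n - k))) * (2 * g - real (n choose 2))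
        = pi * (-1/2) * fact (n - 2) / (fact k * fact (n - k)) * (4 * g - real n * (real n - 1))"
      for g :: real
      by (simp add: real_choose_two[of n, symmetric] field_simps)
    then show ?thesis by (simp only: F_def of_int_1 mult_1_right)
  qed
  have iv: "(\<Sum>U \<in> Pow ([{1..n}]\<^bsup>k\<^esup>). \<Prod>e \<in> [{1..n}]\<^bsup>2\<^esup>.
             cos (- (pi * fact (n - 2) / (fact k * fact (n - k)))
                  + 2 * pi / (real k * (real k - 1)) * real (edge_mult e U))) = P (-1/2) 1"
  proof -
    have "pi * fact (n - 2) / (fact k * fact (n - k))
        = pi * (real ((n - 2) choose (k - 2)) / (real k * (real k - 1)))"
      using fact_quotient_eq_choose[OF assms] by (metis times_divide_eq_right)
    then have "- (pi * fact (n - 2) / (fact k * fact (n - k)))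
          + 2 * pi / (real k * (real k - 1)) * y
        = 2 * pi / (real k * (real k - 1)) * (-1/2 * real ((n - 2) choose (k - 2)) + of_int 1 * y)"
      for y :: real
      by (simp add: diff_divide_distrib right_diff_distrib[of "2 * pi"])
    \<comment> \<open>At m = 1 the exponent is even, which is why (iv) carries no sign.\<close>
    moreover have "(-1::real) powi ((1 + 1) * int j) = 1" for j
      by (simp add: power_int_mult)
    ultimately show ?thesis by (simp only: P_def mult_1_left)
  qed
  have R: "ramsey_number k \<le> n \<longleftrightarrow> ramsey_property k n"
    using assms by (intro ramsey_number_le_iff) simp
  have R_imp: "F q m = 0" if "ramsey_number k \<le> n" for q m
    unfolding F_def using that assms(1) R by (intro sum_graphs_hypergraphs_eq_0) auto
  \<comment> \<open>One instance suffices for the converse: the universal statements (ii) and (iii)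
    specialise to q = -1/2, m = 1.\<close>
  have imp_R: "ramsey_number k \<le> n" if "F (-1/2) 1 = 0"
    unfolding R using ramsey_property_if_sum_eq_0[OF assms] that v by simp
  show ?thesis
    unfolding iv v F_def[symmetric] P_def[symmetric] PF
    using R_imp imp_R by blast
qed

end
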